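(* Let $F$ be a monotone Boolean formula with $m$ inputs. Then the decision problem $\mathrm{EBIC}(F)$ (and hence also the decision problem $\mathrm{AEBIC}(F)$) is in $\Pi^0_1$, i.e. it is co-recursively enumerable.
   Context: All logarithms are in base 2. A random variable $X$ with finite domain $D$ and probability mass function $p$ has entropy $H(X)=-\sum_{x\in D}p(x)\log p(x)$. Given a joint distribution of $n$ random variables $X_1,\dots,X_n$ with finite domains, its entropic function (entropic vector) is $\bm h=(h(\alpha))_{\alpha\subseteq[n]}\in\mathbb R_+^{2^n}$, where $h(\alpha)=H((X_i)_{i\in\alpha})$ and $h(\emptyset)=0$. $\Gamma_n^*\subseteq\mathbb R_+^{2^n}$ denotes the set of all entropic vectors, and $\overline{\Gamma}_n^*$ denotes its topological closure, the set of almost-entropic vectors. For $\bm c,\bm h\in\mathbb R^{2^n}$, $\bm c\cdot\bm h=\sum_{\alpha\subseteq[n]}c_\alpha h(\alpha)$. A Boolean function is a function $F:\{0,1\}^m\to\{0,1\}$; a monotone Boolean formula is one in which no variable is negated. To $F$ and $\bm c_1,\dots,\bm c_m\in\mathbb R^{2^n}$ one associates the Boolean information constraint $F(\bm c_1\cdot\bm h\ge 0,\dots,\bm c_m\cdot\bm h\ge 0)$, where the $j$-th argument of $F$ is the truth value of $\bm c_j\cdot\bm h\ge0$. $\mathrm{EBIC}(F)$ is the decision problem: given integer vectors $\bm c_1,\dots,\bm c_m\in\mathbb Z^{2^n}$, check whether this constraint holds for all $\bm h\in\Gamma_n^*$. $\mathrm{AEBIC}(F)$ is the same problem with $\Gamma_n^*$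 replaced by $\overline{\Gamma}_n^*$. $\Pi^0_1$ is the level of the arithmetical hierarchy consisting of the complements of recursively enumerable sets (inputs are encoded as natural numbers). *)

theory Defs
  imports
    "HOL-Probability.Probability"
    "HOL-Library.Nat_Bijection"
begin

subsection \<open>Recursively enumerable sets\<close>

text \<open>
  Kleene's partial recursive functions. Terms carry no arity: a term denotes one partial function
  for every length of the argument list, and each of these is partial recursive in the usual sense.
\<close>

datatype recf =
    Zero
  | Succ
  | Proj nat
  | Comp recf "recf list"
  | PrimRec recf recf
  | Mu recf

text \<open>
  \<open>recf_eval f xs y\<close> says that \<open>f\<close> is defined on \<open>xs\<close> with value \<open>y\<close>. Recursion is on the first
  argument, with step function \<open>g n r xs\<close> where \<open>r\<close> is the value at \<open>n\<close>; minimisation likewise is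
  over the first argument and requires all earlier values to be defined and nonzero.
\<close>

inductive recf_eval :: "recf \<Rightarrow> nat list \<Rightarrow> nat \<Rightarrow> bool" where
  Zero: "recf_eval Zero xs 0"
| Succ: "recf_eval Succ (x # xs) (Suc x)"
| Proj: "i < length xs \<Longrightarrow> recf_eval (Proj i) xs (xs ! i)"
| Comp: "list_all2 (\<lambda>g y. recf_eval g xs y) gs ys \<Longrightarrow> recf_eval f ys z \<Longrightarrow>
    recf_eval (Comp f gs) xs z"
| PrimRec_0: "recf_eval f xs y \<Longrightarrow> recf_eval (PrimRec f g) (0 # xs) y"
| PrimRec_Suc: "recf_eval (PrimRec f g) (n # xs) r \<Longrightarrow> recf_eval g (n # r # xs) y \<Longrightarrow>
    recf_eval (PrimRec f g) (Suc n # xs) y"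
| Mu: "recf_eval f (n # xs) 0 \<Longrightarrow> (\<And>k. k < n \<Longrightarrow> \<exists>y. recf_eval f (k # xs) (Suc y)) \<Longrightarrow>
    recf_eval (Mu f) xs n"

lemma recf_eval_unique: "recf_eval f xs y \<Longrightarrow> recf_eval f xs z \<Longrightarrow> y = z"
proof (induction arbitrary: z rule: recf_eval.induct)
  case (Comp xs gs ys f w)
  from Comp.prems obtain ys' where ys': "list_all2 (\<lambda>g y. recf_eval g xs y) gs ys'" "recf_eval f ys' z"
    by (cases rule: recf_eval.cases) auto
  have "ys = ys'"
    using Comp.IH(1) ys'(1) by (auto simp: list_all2_conv_all_nth intro!: nth_equalityI)
  with Comp.IH(2) ys'(2) show ?case
    by simp
next
  case (PrimRec_Suc f g n xs r y)
  from PrimRec_Suc.prems obtain r' where "recf_eval (PrimRec f g) (n # xs) r'"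
      "recf_eval g (n # r' # xs) z"
    by (cases rule: recf_eval.cases) auto
  with PrimRec_Suc.IH show ?case
    by metis
next
  case (Mu f n xs)
  from Mu.prems have z: "recf_eval f (z # xs) 0" "\<And>k. k < z \<Longrightarrow> \<exists>y. recf_eval f (k # xs) (Suc y)"
    by (cases rule: recf_eval.cases; auto)+
  show ?case
  proof (rule linorder_cases[of n z])
    assume "n < z"
    with Mu.IH(1) z(2) show ?thesis
      by fastforce
  next
    assume "z < n"
    with Mu.IH(2) z(1) show ?thesis
      by fastforce
  qed simp
qed (erule recf_eval.cases; simp)+

definition rec_enumerable :: "nat set \<Rightarrow> bool" where
  "rec_enumerable A \<longleftrightarrow> (\<exists>f. A = {x. \<exists>y. recf_eval f [x] y})"

definition Pi01 :: "nat set \<Rightarrow> bool" where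
  "Pi01 A \<longleftrightarrow> rec_enumerable (- A)"


subsection \<open>Entropic and almost-entropic vectors\<close>

definition shannon_entropy :: "'a pmf \<Rightarrow> real" where
  "shannon_entropy p = - (\<Sum>x\<in>set_pmf p. pmf p x * log 2 (pmf p x))"

lemma shannon_entropy_domain:
  assumes "finite D" "set_pmf p \<subseteq> D"
  shows "shannon_entropy p = - (\<Sum>x\<in>D. pmf p x * log 2 (pmf p x))"
  unfolding shannon_entropy_def using assms
  by (intro arg_cong[where f = uminus] sum.mono_neutral_left) (auto simp: set_pmf_iff)

text \<open>
  The random variables are indexed by \<open>{..<n}\<close>, and a vector in \<open>\<real>\<close> to the power \<open>2\<^sup>n\<close> is a function
  in \<open>Pow {..<n} \<rightarrow>\<^sub>E UNIV\<close>. Every finite domain is taken to be a set of natural numbers, which is no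
  restriction, as entropy is invariant under renaming of values. A joint distribution is then a
  distribution \<open>p\<close> on the tuples in \<open>Pi\<^sub>E {..<n} D\<close>.
\<close>

definition entropic_vector :: "nat \<Rightarrow> (nat \<Rightarrow> nat) pmf \<Rightarrow> nat set \<Rightarrow> real" where
  "entropic_vector n p =
    (\<lambda>\<alpha>\<in>Pow {..<n}. shannon_entropy (map_pmf (\<lambda>x. restrict x \<alpha>) p))"

definition entropic :: "nat \<Rightarrow> (nat set \<Rightarrow> real) set" where
  "entropic n = {entropic_vector n p | p D.
     (\<forall>i<n. finite (D i)) \<and> set_pmf p \<subseteq> Pi\<^sub>E {..<n} D}"

definition almost_entropic :: "nat \<Rightarrow> (nat set \<Rightarrow> real) set" where
  "almost_entropic n = powertop_real (Pow {..<n}) closure_of entropic n"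

lemma entropic_vector_empty [simp]: "entropic_vector n p {} = 0"
proof -
  have "map_pmf (\<lambda>x. restrict x {}) p = return_pmf (\<lambda>_. undefined)"
    by (simp add: restrict_def map_pmf_const)
  then show ?thesis
    by (simp add: entropic_vector_def shannon_entropy_def del: set_map_pmf)
qed


subsection \<open>Boolean formulas\<close>

datatype bform =
    Const bool
  | Var nat
  | Neg bform
  | And bform bform
  | Or bform bform

text \<open>The Boolean function denoted by a formula, on the list of the truth values of its inputs.\<close>

primrec bform_eval :: "bform \<Rightarrow> bool list \<Rightarrow> bool" where
  "bform_eval (Const b) bs = b"
| "bform_eval (Var i) bs = bs ! i"
| "bform_eval (Neg F) bs = (\<not> bform_eval F bs)"
| "bform_eval (And F G) bs = (bform_eval F bs \<and> bform_eval G bs)"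
| "bform_eval (Or F G) bs = (bform_eval F bs \<or> bform_eval G bs)"

primrec bform_vars :: "bform \<Rightarrow> nat set" where
  "bform_vars (Const b) = {}"
| "bform_vars (Var i) = {i}"
| "bform_vars (Neg F) = bform_vars F"
| "bform_vars (And F G) = bform_vars F \<union> bform_vars G"
| "bform_vars (Or F G) = bform_vars F \<union> bform_vars G"

text \<open>No variable occurs in the scope of a negation.\<close>

primrec monotone_formula :: "bform \<Rightarrow> bool" where
  "monotone_formula (Const b) \<longleftrightarrow> True"
| "monotone_formula (Var i) \<longleftrightarrow> True"
| "monotone_formula (Neg F) \<longleftrightarrow> bform_vars F = {}"
| "monotone_formula (And F G) \<longleftrightarrow> monotone_formula F \<and> monotone_formula G"
| "monotone_formula (Or F G) \<longleftrightarrow> monotone_formula F \<and> monotone_formula G"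


subsection \<open>Boolean information constraints and their decision problems\<close>

definition dot :: "nat \<Rightarrow> (nat set \<Rightarrow> real) \<Rightarrow> (nat set \<Rightarrow> real) \<Rightarrow> real" where
  "dot n c h = (\<Sum>\<alpha>\<in>Pow {..<n}. c \<alpha> * h \<alpha>)"

definition info_constraint ::
  "nat \<Rightarrow> (bool list \<Rightarrow> bool) \<Rightarrow> nat \<Rightarrow> (nat \<Rightarrow> nat set \<Rightarrow> real) \<Rightarrow> (nat set \<Rightarrow> real) \<Rightarrow> bool" where
  "info_constraint m F n c h \<longleftrightarrow> F (map (\<lambda>j. dot n (c j) h \<ge> 0) [0..<m])"

text \<open>
  An instance consists of \<open>n\<close> and integer vectors \<open>c 0, \<dots>, c (m - 1)\<close>. A vector is written as the
  list of its \<open>2 ^ n\<close> entries, the entry for \<open>\<alpha>\<close> being at position \<open>set_encode \<alpha>\<close>, whose binary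
  digits form the indicator of \<open>\<alpha>\<close>.
\<close>

definition encode_instance :: "nat \<Rightarrow> nat \<Rightarrow> (nat \<Rightarrow> nat set \<Rightarrow> int) \<Rightarrow> nat" where
  "encode_instance m n c = prod_encode (n,
     list_encode (map (\<lambda>j. list_encode (map (\<lambda>k. int_encode (c j (set_decode k))) [0..<2 ^ n]))
       [0..<m]))"

definition EBIC :: "nat \<Rightarrow> (bool list \<Rightarrow> bool) \<Rightarrow> nat set" where
  "EBIC m F = {encode_instance m n c | n c.
     \<forall>h\<in>entropic n. info_constraint m F n (\<lambda>j \<alpha>. real_of_int (c j \<alpha>)) h}"

definition AEBIC :: "nat \<Rightarrow> (bool list \<Rightarrow> bool) \<Rightarrow> nat set" where
  "AEBIC m F = {encode_instance m n c | n c.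
     \<forall>h\<in>almost_entropic n. info_constraint m F n (\<lambda>j \<alpha>. real_of_int (c j \<alpha>)) h}"

text \<open>
  An instance is determined by its code, up to the irrelevant values of \<open>c\<close> outside
  \<open>{..<m}\<close> and \<open>Pow {..<n}\<close>.
\<close>

lemma encode_instance_eq_iff:
  "encode_instance m n c = encode_instance m n' c' \<longleftrightarrow>
     n = n' \<and> (\<forall>j<m. \<forall>\<alpha>\<subseteq>{..<n}. c j \<alpha> = c' j \<alpha>)"
proof -
  have dec: "set_decode ` {..<2 ^ n} = Pow {..<n}" for n :: nat
  proof
    show "set_decode ` {..<2 ^ n} \<subseteq> Pow {..<n}"
    proof clarify
      fix k i :: nat
      assume "k < 2 ^ n" "i \<in> set_decode k"
      then have "2 ^ i \<le> k"
        by (auto simp: set_decode_def intro!: leI)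
      with \<open>k < 2 ^ n\<close> have "(2::nat) ^ i < 2 ^ n"
        by linarith
      then show "i < n"
        by simp
    qed
    show "Pow {..<n} \<subseteq> set_decode ` {..<2 ^ n}"
    proof
      fix A assume "A \<in> Pow {..<n}"
      then have A: "A \<subseteq> {..<n}" "finite A"
        by (auto intro: finite_subset)
      have "set_encode A \<le> (\<Sum>i<n. 2 ^ i)"
        unfolding set_encode_def by (rule sum_mono2) (use A in auto)
      also have "\<dots> < (2::nat) ^ n"
        by (induction n) auto
      finally show "A \<in> set_decode ` {..<2 ^ n}"
        by (metis A(2) imageI lessThan_iff set_encode_inverse)
    qed
  qed
  have "(\<forall>k\<in>{..<2 ^ n}. c j (set_decode k) = c' j (set_decode k)) \<longleftrightarrow>
      (\<forall>\<alpha>\<in>Pow {..<n}. c j \<alpha> = c' j \<alpha>)" for j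
    unfolding dec[symmetric] by simp
  then show ?thesis
    by (auto simp: encode_instance_def list_encode_eq int_encode_eq Ball_def)
qed

lemma info_constraint_cong:
  assumes "\<And>j \<alpha>. j < m \<Longrightarrow> \<alpha> \<subseteq> {..<n} \<Longrightarrow> c j \<alpha> = c' j \<alpha>"
  shows "info_constraint m F n c h \<longleftrightarrow> info_constraint m F n c' h"
proof -
  have "map (\<lambda>j. dot n (c j) h \<ge> 0) [0..<m] = map (\<lambda>j. dot n (c' j) h \<ge> 0) [0..<m]"
    using assms by (auto simp: dot_def intro!: sum.cong arg_cong[where f = "(\<le>) 0"])
  then show ?thesis
    by (simp only: info_constraint_def)
qed

lemma encode_instance_in_EBIC_iff:
  "encode_instance m n c \<in> EBIC m F \<longleftrightarrow>
     (\<forall>h\<in>entropic n. info_constraint m F n (\<lambda>j \<alpha>. real_of_int (c j \<alpha>)) h)"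
proof
  assume "encode_instance m n c \<in> EBIC m F"
  then obtain c' where "\<forall>j<m. \<forall>\<alpha>\<subseteq>{..<n}. c j \<alpha> = c' j \<alpha>"
      "\<forall>h\<in>entropic n. info_constraint m F n (\<lambda>j \<alpha>. real_of_int (c' j \<alpha>)) h"
    by (auto simp: EBIC_def encode_instance_eq_iff)
  then show "\<forall>h\<in>entropic n. info_constraint m F n (\<lambda>j \<alpha>. real_of_int (c j \<alpha>)) h"
    using info_constraint_cong[of m n "\<lambda>j \<alpha>. real_of_int (c j \<alpha>)" "\<lambda>j \<alpha>. real_of_int (c' j \<alpha>)"]
    by simp
next
  assume "\<forall>h\<in>entropic n. info_constraint m F n (\<lambda>j \<alpha>. real_of_int (c j \<alpha>)) h"
  then show "encode_instance m n c \<in> EBIC m F"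
    unfolding EBIC_def by blast
qed

lemma encode_instance_in_AEBIC_iff:
  "encode_instance m n c \<in> AEBIC m F \<longleftrightarrow>
     (\<forall>h\<in>almost_entropic n. info_constraint m F n (\<lambda>j \<alpha>. real_of_int (c j \<alpha>)) h)"
proof
  assume "encode_instance m n c \<in> AEBIC m F"
  then obtain c' where "\<forall>j<m. \<forall>\<alpha>\<subseteq>{..<n}. c j \<alpha> = c' j \<alpha>"
      "\<forall>h\<in>almost_entropic n. info_constraint m F n (\<lambda>j \<alpha>. real_of_int (c' j \<alpha>)) h"
    by (auto simp: AEBIC_def encode_instance_eq_iff)
  then show "\<forall>h\<in>almost_entropic n. info_constraint m F n (\<lambda>j \<alpha>. real_of_int (c j \<alpha>)) h"
    using info_constraint_cong[of m n "\<lambda>j \<alpha>. real_of_int (c j \<alpha>)" "\<lambda>j \<alpha>. real_of_int (c' j \<alpha>)"]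
    by simp
next
  assume "\<forall>h\<in>almost_entropic n. info_constraint m F n (\<lambda>j \<alpha>. real_of_int (c j \<alpha>)) h"
  then show "encode_instance m n c \<in> AEBIC m F"
    unfolding AEBIC_def by blast
qed

end

theory Submission
  imports Defs
begin

text \<open>
  For monotone \<open>F\<close> the set of vectors satisfying a constraint is closed, because its atoms are weak
  linear inequalities; hence EBIC and AEBIC coincide, and a constraint that fails on an entropic
  vector already fails on the entropic vector of a rational distribution, that is, of the image
  of a uniform distribution on \<open>{..<N}\<close>. For such a distribution
  \<open>N * h(\<alpha>) = (\<Sum>i<N. log (N / c))\<close>, where \<open>c\<close> is the number of \<open>j < N\<close> on which the variables
  indexed by \<open>\<alpha>\<close> agree with their values at \<open>i\<close>. The sign of an integer combination of these
  entropies is therefore decided by comparing two products of powers of natural numbers, so that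
  failure of the constraint is witnessed by a number on which a decidable test succeeds.
\<close>

subsection \<open>Total computable functions\<close>

text \<open>
  The list is an environment of variables with the innermost one first: a function binding a
  variable conses it, so that bound variables are read off by \<open>hd\<close> and weakening is \<open>tl\<close>.
\<close>

definition computable :: "nat \<Rightarrow> (nat list \<Rightarrow> nat) \<Rightarrow> bool" where
  "computable k f \<longleftrightarrow> (\<exists>r. \<forall>xs. length xs = k \<longrightarrow> recf_eval r xs (f xs))"

abbreviation decidable :: "nat \<Rightarrow> (nat list \<Rightarrow> bool) \<Rightarrow> bool" where
  "decidable k P \<equiv> computable k (\<lambda>xs. of_bool (P xs))"

named_theorems computable_intros

section \<open>Projections, weakening and primitive recursion\<close>

lemma computable_hd [computable_intros]: "computable (Suc k) (\<lambda>xs. hd xs)"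
  unfolding computable_def
proof (intro exI allI impI)
  fix xs :: "nat list" assume "length xs = Suc k"
  then show "recf_eval (Proj 0) xs (hd xs)"
    using recf_eval.Proj[of 0 xs] by (cases xs) auto
qed

lemma computable_tl [computable_intros]:
  assumes "computable k f"
  shows "computable (Suc k) (\<lambda>xs. f (tl xs))"
proof -
  obtain r where r: "\<And>xs. length xs = k \<Longrightarrow> recf_eval r xs (f xs)"
    using assms by (auto simp: computable_def)
  have "recf_eval (Comp r (map (\<lambda>i. Proj (Suc i)) [0..<k])) xs (f (tl xs))"
    if "length xs = Suc k" for xs
  proof (rule recf_eval.Comp)
    show "list_all2 (\<lambda>g y. recf_eval g xs y) (map (\<lambda>i. Proj (Suc i)) [0..<k]) (tl xs)"
      using that by (auto simp: list_all2_conv_all_nth nth_tl intro!: recf_eval.Proj)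
  qed (use that r in auto)
  then show ?thesis
    by (auto simp: computable_def)
qed

lemma computable_Suc [computable_intros]:
  assumes "computable k f"
  shows "computable k (\<lambda>xs. Suc (f xs))"
proof -
  obtain r where r: "\<And>xs. length xs = k \<Longrightarrow> recf_eval r xs (f xs)"
    using assms by (auto simp: computable_def)
  have "recf_eval (Comp Succ [r]) xs (Suc (f xs))" if "length xs = k" for xs
    by (rule recf_eval.Comp[where ys = "[f xs]"]) (use that r in \<open>auto intro: recf_eval.Succ\<close>)
  then show ?thesis
    by (auto simp: computable_def)
qed

lemma computable_const [computable_intros]: "computable k (\<lambda>_. c)"
proof (induction c)
  case 0
  then show ?case
    by (auto simp: computable_def intro: recf_eval.Zero)
qed (rule computable_Suc)

text \<open>The environment order matches \<open>PrimRec\<close>: a step function sees the counter,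
  the previous value and then the outer variables.\<close>

lemma computable_rec [computable_intros]:
  assumes "computable k a" "computable k f"
    and "computable (Suc (Suc k)) (\<lambda>ys. g (hd ys) (hd (tl ys)) (tl (tl ys)))"
  shows "computable k (\<lambda>xs. rec_nat (f xs) (\<lambda>n r. g n r xs) (a xs))"
proof -
  obtain ra rf rg where
    ra: "\<And>xs. length xs = k \<Longrightarrow> recf_eval ra xs (a xs)" and
    rf: "\<And>xs. length xs = k \<Longrightarrow> recf_eval rf xs (f xs)" and
    rg: "\<And>xs. length xs = Suc (Suc k) \<Longrightarrow> recf_eval rg xs (g (hd xs) (hd (tl xs)) (tl (tl xs)))"
    using assms unfolding computable_def by metis
  have rec: "recf_eval (PrimRec rf rg) (n # xs) (rec_nat (f xs) (\<lambda>n r. g n r xs) n)"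
    if "length xs = k" for n xs
  proof (induction n)
    case (Suc n)
    then show ?case
      using rg[of "n # rec_nat (f xs) (\<lambda>n r. g n r xs) n # xs"] that
      by (auto intro: recf_eval.PrimRec_Suc)
  qed (use rf that in \<open>auto intro: recf_eval.PrimRec_0\<close>)
  have "recf_eval (Comp (PrimRec rf rg) (ra # map Proj [0..<k])) xs
      (rec_nat (f xs) (\<lambda>n r. g n r xs) (a xs))" if "length xs = k" for xs
  proof (rule recf_eval.Comp)
    show "list_all2 (\<lambda>g y. recf_eval g xs y) (ra # map Proj [0..<k]) (a xs # xs)"
      using that ra by (auto simp: list_all2_conv_all_nth nth_Cons' intro!: recf_eval.Proj)
  qed (use that rec in auto)
  then show ?thesis
    by (auto simp: computable_def)
qed

text \<open>\<open>Mu\<close> searches for a zero, which \<open>of_bool\<close> takes exactly where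
  \<open>P\<close> fails. Totality of \<open>r\<close> lets the search pass every smaller
  candidate.\<close>

lemma rec_enumerable_projection:
  assumes "decidable (Suc (Suc 0)) (\<lambda>xs. P (hd xs) (hd (tl xs)))"
  shows "rec_enumerable {x. \<exists>w. \<not> P w x}"
proof -
  obtain r where r: "\<And>w x. recf_eval r [w, x] (of_bool (P w x))"
    using assms unfolding computable_def by (metis length_Cons list.sel(1,3) list.size(3))
  have "(\<exists>y. recf_eval (Mu r) [x] y) \<longleftrightarrow> (\<exists>w. \<not> P w x)" for x
  proof
    assume "\<exists>y. recf_eval (Mu r) [x] y"
    then obtain w where "recf_eval r [w, x] 0"
      by (auto elim: recf_eval.cases)
    with r[of w x] show "\<exists>w. \<not> P w x"
      by (auto dest: recf_eval_unique)
  next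
    assume ex: "\<exists>w. \<not> P w x"
    define w where "w = (LEAST w. \<not> P w x)"
    have "recf_eval (Mu r) [x] w"
    proof (rule recf_eval.Mu)
      show "recf_eval r [w, x] 0"
        using LeastI_ex[OF ex] r[of w x] by (simp add: w_def)
      show "\<exists>y. recf_eval r [v, x] (Suc y)" if "v < w" for v
        using not_less_Least[of v "\<lambda>w. \<not> P w x"] that r[of v x] by (auto simp: w_def)
    qed
    then show "\<exists>y. recf_eval (Mu r) [x] y" ..
  qed
  then show ?thesis
    by (auto simp: rec_enumerable_def intro!: exI[of _ "Mu r"])
qed

section \<open>Arithmetic, bounded sums and bounded products\<close>

lemma computable_add [computable_intros]:
  assumes "computable k a" "computable k b"
  shows "computable k (\<lambda>xs. a xs + b xs)"
proof -
  have "a + b = rec_nat b (\<lambda>_ r. Suc r) a" for a b :: nat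
    by (induction a) auto
  then show ?thesis
    by (simp only:) (intro computable_intros assms)
qed

lemma computable_diff [computable_intros]:
  assumes "computable k a" "computable k b"
  shows "computable k (\<lambda>xs. a xs - b xs)"
proof -
  \<comment> \<open>The counter of the last step is the predecessor; the previous value is
    ignored.\<close>
  have pred: "a - 1 = rec_nat 0 (\<lambda>n _. n) a" for a :: nat
    by (cases a) auto
  have "a - b = rec_nat a (\<lambda>_ r. rec_nat 0 (\<lambda>n _. n) r) b" for a b :: nat
    by (induction b) (auto simp flip: pred)
  then show ?thesis
    by (simp only:) (intro computable_intros assms)
qed

lemma computable_mult [computable_intros]:
  assumes "computable k a" "computable k b"
  shows "computable k (\<lambda>xs. a xs * b xs)"
proof -
  have "a * b = rec_nat 0 (\<lambda>_ r. r + b) a" for a b :: nat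
    by (induction a) auto
  then show ?thesis
    by (simp only:) (intro computable_intros assms)
qed

lemma computable_power [computable_intros]:
  assumes "computable k a" "computable k b"
  shows "computable k (\<lambda>xs. a xs ^ b xs)"
proof -
  have "a ^ b = rec_nat 1 (\<lambda>_ r. a * r) b" for a b :: nat
    by (induction b) auto
  then show ?thesis
    by (simp only:) (intro computable_intros assms)
qed

text \<open>In a recursion step the accumulator sits between the counter and the outer variables; a
  summand or factor has to be read past it.\<close>

lemma computable_skip:
  assumes "computable (Suc k) (\<lambda>ys. f (hd ys) (tl ys))"
  shows "computable (Suc (Suc k)) (\<lambda>ys. f (hd ys) (tl (tl ys)))"
proof -
  obtain r where r: "\<And>xs. length xs = Suc k \<Longrightarrow> recf_eval r xs (f (hd xs) (tl xs))"
    using assms by (auto simp: computable_def)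
  have "recf_eval (Comp r (Proj 0 # map (\<lambda>i. Proj (Suc (Suc i))) [0..<k])) xs (f (hd xs) (tl (tl xs)))"
    if len: "length xs = Suc (Suc k)" for xs
  proof (rule recf_eval.Comp)
    obtain a b zs where "xs = a # b # zs" "length zs = k"
      using len by (auto simp: length_Suc_conv)
    then show "list_all2 (\<lambda>g y. recf_eval g xs y) (Proj 0 # map (\<lambda>i. Proj (Suc (Suc i))) [0..<k])
        (hd xs # tl (tl xs))"
      using recf_eval.Proj[of 0 xs] recf_eval.Proj[of "Suc (Suc i)" xs for i]
      by (auto simp: list_all2_conv_all_nth nth_Cons split: nat.split)
    show "recf_eval r (hd xs # tl (tl xs)) (f (hd xs) (tl (tl xs)))"
      using r[of "hd xs # tl (tl xs)"] len by simp
  qed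
  then show ?thesis
    by (auto simp: computable_def)
qed

lemma computable_sum [computable_intros]:
  assumes "computable k a" "computable (Suc k) (\<lambda>ys. f (hd ys) (tl ys))"
  shows "computable k (\<lambda>xs. \<Sum>i<a xs. f i xs)"
proof -
  have eq: "(\<Sum>i<a. f i xs) = rec_nat 0 (\<lambda>i r. r + f i xs) a" for a xs
    by (induction a) auto
  show ?thesis
    unfolding eq by (intro computable_intros computable_skip assms)
qed

lemma computable_prod [computable_intros]:
  assumes "computable k a" "computable (Suc k) (\<lambda>ys. f (hd ys) (tl ys))"
  shows "computable k (\<lambda>xs. \<Prod>i<a xs. f i xs)"
proof -
  have eq: "(\<Prod>i<a. f i xs) = rec_nat 1 (\<lambda>i r. r * f i xs) a" for a xs
    by (induction a) auto
  show ?thesis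
    unfolding eq by (intro computable_intros computable_skip assms)
qed

section \<open>Decidable predicates, case distinction and division\<close>

lemma decidable_Not [computable_intros]:
  assumes "decidable k P"
  shows "decidable k (\<lambda>xs. \<not> P xs)"
proof -
  have "of_bool (\<not> P xs) = 1 - (of_bool (P xs) :: nat)" for xs
    by simp
  then show ?thesis
    by (simp only:) (intro computable_intros assms)
qed

lemma decidable_conj [computable_intros]:
  assumes "decidable k P" "decidable k Q"
  shows "decidable k (\<lambda>xs. P xs \<and> Q xs)"
  unfolding of_bool_conj by (intro computable_intros assms)

lemma decidable_disj [computable_intros]:
  assumes "decidable k P" "decidable k Q"
  shows "decidable k (\<lambda>xs. P xs \<or> Q xs)"
proof -
  have "P \<or> Q \<longleftrightarrow> \<not> (\<not> P \<and> \<not> Q)" for P Q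
    by simp
  then show ?thesis
    by (simp only:) (intro computable_intros assms)
qed

lemma decidable_imp [computable_intros]:
  assumes "decidable k P" "decidable k Q"
  shows "decidable k (\<lambda>xs. P xs \<longrightarrow> Q xs)"
  unfolding imp_conv_disj by (intro computable_intros assms)

lemma decidable_le [computable_intros]:
  assumes "computable k a" "computable k b"
  shows "decidable k (\<lambda>xs. a xs \<le> b xs)"
proof -
  have "of_bool (a \<le> b) = 1 - (a - b)" for a b :: nat
    by auto
  then show ?thesis
    by (simp only:) (intro computable_intros assms)
qed

lemma decidable_eq [computable_intros]:
  assumes "computable k a" "computable k b"
  shows "decidable k (\<lambda>xs. a xs = b xs)"
  unfolding order.eq_iff by (intro computable_intros assms)

lemma decidable_all [computable_intros]:
  assumes "computable k a" "decidable (Suc k) (\<lambda>ys. P (hd ys) (tl ys))"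
  shows "decidable k (\<lambda>xs. \<forall>i<a xs. P i xs)"
proof -
  have "of_bool (\<forall>i<a. P i xs) = (\<Prod>i<a. of_bool (P i xs) :: nat)" for a xs
    by (induction a) (auto simp: less_Suc_eq)
  then show ?thesis
    by (simp only:) (intro computable_intros assms)
qed

lemma computable_if [computable_intros]:
  assumes "decidable k P" "computable k a" "computable k b"
  shows "computable k (\<lambda>xs. if P xs then a xs else b xs)"
proof -
  have "(if P xs then a xs else b xs) = of_bool (P xs) * a xs + of_bool (\<not> P xs) * b xs" for xs
    by simp
  then show ?thesis
    by (simp only:) (intro computable_intros assms)
qed

lemma computable_div [computable_intros]:
  assumes "computable k a" "computable k b"
  shows "computable k (\<lambda>xs. a xs div b xs)"
proof -
  \<comment> \<open>The quotient counts the positive multiples of \<open>b\<close> up to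
    \<open>a\<close>; the test \<open>b \<noteq> 0\<close> yields the value \<open>0\<close> for
    division by zero.\<close>
  have "a div b = (\<Sum>i<a. of_bool (b \<noteq> 0 \<and> Suc i * b \<le> a))" for a b :: nat
  proof (cases "b = 0")
    case False
    have "{i. i < a \<and> Suc i * b \<le> a} = {..<a div b}"
    proof -
      have "Suc i * b \<le> a \<longleftrightarrow> i < a div b" for i
        using False by (metis Suc_le_eq less_eq_div_iff_mult_less_eq neq0_conv)
      then show ?thesis
        by (auto intro: less_le_trans)
    qed
    then show ?thesis
      using False by (simp add: of_bool_def sum.If_cases Int_def conj_commute del: mult_Suc)
  qed simp
  then show ?thesis
    by (simp only:) (intro computable_intros assms)
qed

lemma computable_mod [computable_intros]:
  assumes "computable k a" "computable k b"
  shows "computable k (\<lambda>xs. a xs mod b xs)"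
  unfolding minus_div_mult_eq_mod[symmetric] by (intro computable_intros assms)

subsection \<open>Pairs and lists as numbers\<close>

lemma prod_encode_le_imp: "prod_encode (i, j) = z \<Longrightarrow> i < Suc z \<and> j < Suc z"
  using le_prod_encode_1[of i j] le_prod_encode_2[of j i] by auto

text \<open>Both components of a pair are at most its code, and only one pair has code
  \<open>z\<close>, so bounded sums suffice for decoding.\<close>

lemma sum_prod_decode:
  "(\<Sum>i<Suc z. \<Sum>j<Suc z. of_bool (prod_encode (i, j) = z) * f i j) =
     (f (fst (prod_decode z)) (snd (prod_decode z)) :: nat)"
proof -
  obtain a b where ab: "prod_decode z = (a, b)"
    by (cases "prod_decode z")
  then have z: "prod_encode (i, j) = z \<longleftrightarrow> i = a \<and> j = b" for i j
    by (metis prod.inject prod_decode_inverse prod_encode_inverse)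
  have "a < Suc z" "b < Suc z"
    using prod_encode_le_imp[of a b z] z by auto
  then show ?thesis
    by (simp add: ab z of_bool_conj mult.assoc del: sum.lessThan_Suc flip: sum_distrib_left)
qed

lemma computable_prod_decode [computable_intros]:
  assumes "computable k a"
  shows "computable k (\<lambda>xs. fst (prod_decode (a xs)))"
    and "computable k (\<lambda>xs. snd (prod_decode (a xs)))"
proof -
  \<comment> \<open>\<open>prod_encode\<close> is replaced by Cantor's polynomial, to which the
    closure rules apply.\<close>
  have "fst (prod_decode z) = (\<Sum>i<Suc z. \<Sum>j<Suc z. of_bool ((i + j) * Suc (i + j) div 2 + i = z) * i)"
    "snd (prod_decode z) = (\<Sum>i<Suc z. \<Sum>j<Suc z. of_bool ((i + j) * Suc (i + j) div 2 + i = z) * j)" for z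
    using sum_prod_decode[of z "\<lambda>i j. i"] sum_prod_decode[of z "\<lambda>i j. j"]
    by (simp_all only: prod_encode_def triangle_def case_prod_conv)
  then show "computable k (\<lambda>xs. fst (prod_decode (a xs)))"
    "computable k (\<lambda>xs. snd (prod_decode (a xs)))"
    by (simp_all only:) (intro computable_intros assms)+
qed

text \<open>\<open>list_encode\<close> maps a nonempty list to \<open>Suc\<close> of the pair code
  of its head and its coded tail, whence the \<open>r - 1\<close>.\<close>

definition code_drop :: "nat \<Rightarrow> nat \<Rightarrow> nat" where
  "code_drop z i = rec_nat z (\<lambda>_ r. snd (prod_decode (r - 1))) i"

definition code_nth :: "nat \<Rightarrow> nat \<Rightarrow> nat" where
  "code_nth z i = fst (prod_decode (code_drop z i - 1))"

lemma code_drop_list_encode: "code_drop (list_encode xs) i = list_encode (drop i xs)"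
proof (induction i)
  case (Suc i)
  \<comment> \<open>Needed past the end of the list: \<open>0 - 1\<close> is \<open>0\<close>, whose
    second component is \<open>0\<close>, again the code of the empty list.\<close>
  have prod_0: "prod_decode 0 = (0, 0)"
    using prod_encode_inverse[of "(0, 0)"] by (simp add: prod_encode_def)
  have "snd (prod_decode (list_encode xs - 1)) = list_encode (tl xs)" for xs
    using prod_0 by (cases xs) auto
  with Suc show ?case
    by (simp add: code_drop_def drop_Suc tl_drop)
qed (simp add: code_drop_def)

lemma code_nth_list_encode: "i < length xs \<Longrightarrow> code_nth (list_encode xs) i = xs ! i"
  by (simp add: code_nth_def code_drop_list_encode flip: Cons_nth_drop_Suc)

text \<open>The length is tested rather than computed: nothing remains after \<open>l\<close> steps,
  but something does one step earlier. For \<open>l = 0\<close> there is no earlier step.\<close>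

definition code_length_eq :: "nat \<Rightarrow> nat \<Rightarrow> bool" where
  "code_length_eq z l \<longleftrightarrow> code_drop z l = 0 \<and> (l = 0 \<or> code_drop z (l - 1) \<noteq> 0)"

lemma code_length_eq_list_encode: "code_length_eq (list_encode xs) l \<longleftrightarrow> length xs = l"
proof -
  have "list_encode ys = 0 \<longleftrightarrow> ys = []" for ys
    by (cases ys) simp_all
  then have "code_length_eq (list_encode xs) l \<longleftrightarrow> length xs \<le> l \<and> (l = 0 \<or> \<not> length xs \<le> l - 1)"
    by (simp add: code_length_eq_def code_drop_list_encode)
  also have "\<dots> \<longleftrightarrow> length xs = l"
    by arith
  finally show ?thesis .
qed

lemma computable_code [computable_intros]:
  assumes "computable k a" "computable k b"
  shows "computable k (\<lambda>xs. code_drop (a xs) (b xs))"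
    and "computable k (\<lambda>xs. code_nth (a xs) (b xs))"
    and "decidable k (\<lambda>xs. code_length_eq (a xs) (b xs))"
  unfolding code_length_eq_def code_nth_def code_drop_def by (intro computable_intros assms)+

subsection \<open>Entropies of rational distributions\<close>

text \<open>Positive and negative part of a coded integer, as natural numbers. Even codes are the
  nonnegative integers; an odd code \<open>e\<close> stands for
  \<open>- (e div 2) - 1\<close>.\<close>

definition pos_code :: "nat \<Rightarrow> nat" where
  "pos_code e = (if e mod 2 = 0 then e div 2 else 0)"

definition neg_code :: "nat \<Rightarrow> nat" where
  "neg_code e = (if e mod 2 = 0 then 0 else Suc (e div 2))"

lemma int_decode_eq_diff: "int_decode e = int (pos_code e) - int (neg_code e)"
  by (simp add: int_decode_def sum_decode_def pos_code_def neg_code_def even_iff_mod_2_eq_zero)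

text \<open>Lets a sum over sets of variables run over numbers below \<open>2 ^ n\<close>, as the
  computable test does.\<close>

lemma bij_betw_set_decode: "bij_betw set_decode {..<2 ^ n} (Pow {..<n})"
proof (rule bij_betwI[where g = set_encode])
  have le: "set_encode A < 2 ^ n" if "A \<subseteq> {..<n}" for A
  proof -
    have "set_encode A \<le> (\<Sum>i<n. 2 ^ i)"
      unfolding set_encode_def by (rule sum_mono2) (use that in auto)
    also have "\<dots> < (2::nat) ^ n"
      by (induction n) auto
    finally show ?thesis .
  qed
  then show "set_encode \<in> Pow {..<n} \<rightarrow> {..<2 ^ n}"
    by auto
  show "set_decode \<in> {..<2 ^ n} \<rightarrow> Pow {..<n}"
  proof clarify
    fix k i :: nat
    assume "k < 2 ^ n" "i \<in> set_decode k"
    then have "2 ^ i \<le> k"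
      by (auto simp: set_decode_def intro!: leI)
    with \<open>k < 2 ^ n\<close> have "(2::nat) ^ i < 2 ^ n"
      by linarith
    then show "i < n"
      by simp
  qed
  show "set_decode (set_encode A) = A" if "A \<in> Pow {..<n}" for A
    using that by (intro set_encode_inverse) (auto intro: finite_subset)
qed simp

text \<open>\<open>t\<close> is read as a table whose row \<open>i\<close> lists the values of the
  \<open>n\<close> variables at the \<open>i\<close>-th sample point. As \<open>code_nth\<close> is
  total, every number is a table, and a search may run over all of them.\<close>

definition outcome :: "nat \<Rightarrow> nat \<Rightarrow> nat \<Rightarrow> nat \<Rightarrow> nat" where
  "outcome n t i = (\<lambda>v\<in>{..<n}. code_nth (code_nth t i) v)"

definition sample_pmf :: "nat \<Rightarrow> nat \<Rightarrow> nat \<Rightarrow> (nat \<Rightarrow> nat) pmf" where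
  "sample_pmf n N t = map_pmf (outcome n t) (pmf_of_set {..<N})"

text \<open>The condition on \<open>k div 2 ^ v\<close> is membership of \<open>v\<close> in
  \<open>set_decode k\<close>. Divided by \<open>N\<close>, the count is the marginal probability of
  the value taken at sample point \<open>i\<close>.\<close>

definition agree_count :: "nat \<Rightarrow> nat \<Rightarrow> nat \<Rightarrow> nat \<Rightarrow> nat \<Rightarrow> nat" where
  "agree_count n N t k i = (\<Sum>i'<N. of_bool (\<forall>v<n. k div 2 ^ v mod 2 = 1 \<longrightarrow>
     code_nth (code_nth t i') v = code_nth (code_nth t i) v))"

text \<open>The sign of an entropy combination, with negative exponents moved to the other side.\<close>

definition nonneg_test :: "nat \<Rightarrow> nat \<Rightarrow> nat \<Rightarrow> nat \<Rightarrow> bool" where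
  "nonneg_test n N t e \<longleftrightarrow>
     (\<Prod>k<2 ^ n. \<Prod>i<N. N ^ neg_code (code_nth e k) * agree_count n N t k i ^ pos_code (code_nth e k))
     \<le> (\<Prod>k<2 ^ n. \<Prod>i<N. N ^ pos_code (code_nth e k) * agree_count n N t k i ^ neg_code (code_nth e k))"

lemma decidable_nonneg_test [computable_intros]:
  assumes "computable k n" "computable k N" "computable k t" "computable k e"
  shows "decidable k (\<lambda>xs. nonneg_test (n xs) (N xs) (t xs) (e xs))"
  unfolding nonneg_test_def agree_count_def pos_code_def neg_code_def
  by (intro computable_intros assms)

section \<open>Correctness of the sign test\<close>

lemma agree_count_eq_card:
  assumes "set_decode k \<subseteq> {..<n}"
  shows "agree_count n N t k i =
    card {i'\<in>{..<N}. restrict (outcome n t i') (set_decode k) = restrict (outcome n t i) (set_decode k)}"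
proof -
  have "(\<forall>v<n. k div 2 ^ v mod 2 = 1 \<longrightarrow> code_nth (code_nth t i') v = code_nth (code_nth t i) v) \<longleftrightarrow>
      restrict (outcome n t i') (set_decode k) = restrict (outcome n t i) (set_decode k)" for i'
    using assms by (auto simp: outcome_def set_decode_def fun_eq_iff restrict_def odd_iff_mod_2_eq_one)
  then show ?thesis
    by (simp add: agree_count_def of_bool_def sum.If_cases Int_def)
qed

text \<open>Averaging the information content over sample points instead of values gives the same
  sum, since each value is hit in proportion to its probability.\<close>

lemma shannon_entropy_map_pmf_of_set:
  assumes A: "finite A" "A \<noteq> {}"
  shows "shannon_entropy (map_pmf f (pmf_of_set A)) =
    (\<Sum>i\<in>A. log 2 (card A / card {j\<in>A. f j = f i})) / card A"
proof -
  define q where "q y = card {j\<in>A. f j = y} / card A" for y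
  have pmf: "pmf (map_pmf f (pmf_of_set A)) y = q y" for y
    using A by (simp add: pmf_map measure_pmf_of_set q_def vimage_def Int_def)
  \<comment> \<open>The weight \<open>q y\<close> is spread evenly over the fibre of
    \<open>y\<close>, each point receiving \<open>1 / card A\<close>.\<close>
  have "(\<Sum>y\<in>f ` A. q y * log 2 (q y)) = (\<Sum>y\<in>f ` A. \<Sum>i\<in>{i\<in>A. f i = y}. log 2 (q (f i)) / card A)"
    by (intro sum.cong) (simp_all add: q_def)
  also have "\<dots> = (\<Sum>i\<in>A. log 2 (q (f i)) / card A)"
    by (rule sum.image_gen[OF A(1), symmetric])
  also have "\<dots> = - (\<Sum>i\<in>A. log 2 (card A / card {j\<in>A. f j = f i})) / card A"
  proof -
    have "log 2 (q (f i)) = - log 2 (card A / card {j\<in>A. f j = f i})" if "i \<in> A" for i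
    proof -
      have "card {j\<in>A. f j = f i} > 0"
        using that A by (auto simp: card_gt_0_iff)
      moreover have "card A > 0"
        using A by (simp add: card_gt_0_iff)
      ultimately show ?thesis
        unfolding q_def by (simp add: log_divide)
    qed
    then show ?thesis
      by (simp add: sum_negf flip: sum_divide_distrib)
  qed
  finally show ?thesis
    using A by (simp add: shannon_entropy_def pmf)
qed

text \<open>Scaled by \<open>N * ln 2\<close>, the entropy combination is the difference of the
  logarithms of the two products, and \<open>ln\<close> is strictly increasing on positive
  reals.\<close>

lemma nonneg_test_iff:
  assumes N: "N > 0"
  shows "nonneg_test n N t e \<longleftrightarrow>
    dot n (\<lambda>\<alpha>. real_of_int (int_decode (code_nth e (set_encode \<alpha>)))) (entropic_vector n (sample_pmf n N t)) \<ge> 0"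
proof -
  define a b where "a k = pos_code (code_nth e k)" and "b k = neg_code (code_nth e k)" for k
  define c where "c k i = agree_count n N t k i" for k i
  define H where "H = entropic_vector n (sample_pmf n N t)"
  have dec: "set_decode k \<subseteq> {..<n}" if "k < 2 ^ n" for k
    using bij_betw_apply[OF bij_betw_set_decode, of k n] that by auto
  \<comment> \<open>Every sample point agrees with itself, so all logarithms below are of positive
    numbers.\<close>
  have c_pos: "c k i > 0" if "k < 2 ^ n" "i < N" for k i
    using that dec by (auto simp: c_def agree_count_eq_card card_gt_0_iff)
  have c_nz: "c k i \<noteq> 0" if "k < 2 ^ n" "i < N" for k i
    using c_pos[OF that] by simp
  \<comment> \<open>The factor \<open>N * ln 2\<close> clears the average over the samples and the
    change from base 2 to \<open>ln\<close>.\<close>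
  have H: "N * ln 2 * H (set_decode k) = (\<Sum>i<N. ln N - ln (c k i))" if k: "k < 2 ^ n" for k
  proof -
    have "H (set_decode k) = shannon_entropy
        (map_pmf (\<lambda>i. restrict (outcome n t i) (set_decode k)) (pmf_of_set {..<N}))"
      using dec[OF k] by (simp add: H_def entropic_vector_def sample_pmf_def pmf.map_comp o_def)
    also have "\<dots> = (\<Sum>i<N. log 2 (N / c k i)) / N"
      using N by (subst shannon_entropy_map_pmf_of_set) (auto simp: c_def agree_count_eq_card dec k)
    also have "(\<Sum>i<N. log 2 (N / c k i)) = (\<Sum>i<N. ln N - ln (c k i)) / ln 2"
      unfolding sum_divide_distrib
      by (intro sum.cong) (use c_pos[OF k] N in \<open>auto simp: log_def ln_div\<close>)
    finally show ?thesis
      using N by (simp add: field_simps)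
  qed
  have "N * ln 2 * dot n (\<lambda>\<alpha>. real_of_int (int_decode (code_nth e (set_encode \<alpha>)))) H =
      N * ln 2 * (\<Sum>k<2 ^ n. (real (a k) - real (b k)) * H (set_decode k))"
    unfolding dot_def
    by (subst sum.reindex_bij_betw[OF bij_betw_set_decode, symmetric])
      (simp add: int_decode_eq_diff a_def b_def)
  also have "\<dots> = (\<Sum>k<2 ^ n. (real (a k) - real (b k)) * (\<Sum>i<N. ln N - ln (c k i)))"
    unfolding sum_distrib_left[of "N * ln 2"] by (intro sum.cong) (simp_all flip: H)
  \<comment> \<open>Expanding \<open>(a - b) * (ln N - ln c)\<close> and collecting the terms by
    sign gives exactly the exponents on the two sides of the test.\<close>
  also have "\<dots> = (\<Sum>k<2 ^ n. \<Sum>i<N. a k * ln N + b k * ln (c k i)) -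
      (\<Sum>k<2 ^ n. \<Sum>i<N. b k * ln N + a k * ln (c k i))"
    by (simp add: sum_distrib_left algebra_simps flip: sum_subtractf)
  finally have dot: "N * ln 2 * dot n (\<lambda>\<alpha>. real_of_int (int_decode (code_nth e (set_encode \<alpha>)))) H = \<dots>" .
  have ln_prod: "ln (\<Prod>k<2 ^ n. \<Prod>i<N. real (N ^ u k * c k i ^ v k)) =
      (\<Sum>k<2 ^ n. \<Sum>i<N. u k * ln N + v k * ln (c k i))" for u v :: "nat \<Rightarrow> nat"
  proof -
    have "ln (\<Prod>k<2 ^ n. \<Prod>i<N. real (N ^ u k * c k i ^ v k)) =
        (\<Sum>k<2 ^ n. ln (\<Prod>i<N. real (N ^ u k * c k i ^ v k)))"
      using N c_nz by (intro ln_prod) auto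
    also have "\<dots> = (\<Sum>k<2 ^ n. \<Sum>i<N. ln (real (N ^ u k * c k i ^ v k)))"
      using N c_nz by (intro sum.cong ln_prod) auto
    also have "\<dots> = (\<Sum>k<2 ^ n. \<Sum>i<N. u k * ln N + v k * ln (c k i))"
    proof (intro sum.cong refl)
      fix k i :: nat assume "k \<in> {..<2 ^ n}" "i \<in> {..<N}"
      then have "real (c k i) > 0"
        using c_pos by simp
      then show "ln (real (N ^ u k * c k i ^ v k)) = u k * ln N + v k * ln (c k i)"
        using N by (simp add: ln_mult ln_realpow)
    qed
    finally show ?thesis .
  qed
  have pos: "(\<Prod>k<2 ^ n. \<Prod>i<N. real (N ^ u k * c k i ^ v k)) > 0" for u v :: "nat \<Rightarrow> nat"
    using N c_pos by (intro prod_pos) auto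
  have "nonneg_test n N t e \<longleftrightarrow>
      real (\<Prod>k<2 ^ n. \<Prod>i<N. N ^ b k * c k i ^ a k) \<le> real (\<Prod>k<2 ^ n. \<Prod>i<N. N ^ a k * c k i ^ b k)"
    unfolding of_nat_le_iff by (simp add: nonneg_test_def a_def b_def c_def)
  also have "\<dots> \<longleftrightarrow> ln (\<Prod>k<2 ^ n. \<Prod>i<N. real (N ^ b k * c k i ^ a k))
      \<le> ln (\<Prod>k<2 ^ n. \<Prod>i<N. real (N ^ a k * c k i ^ b k))"
    unfolding of_nat_prod using ln_le_cancel_iff[OF pos pos] by simp
  also have "\<dots> \<longleftrightarrow> 0 \<le> N * ln 2 * dot n (\<lambda>\<alpha>. real_of_int (int_decode (code_nth e (set_encode \<alpha>)))) H"
    unfolding dot ln_prod by simp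
  also have "\<dots> \<longleftrightarrow> 0 \<le> dot n (\<lambda>\<alpha>. real_of_int (int_decode (code_nth e (set_encode \<alpha>)))) H"
  proof -
    have "real N * ln 2 > 0"
      using N by simp
    then show ?thesis
      by (metis mult_le_cancel_left_pos mult_zero_right)
  qed
  finally show ?thesis
    by (simp add: H_def)
qed

lemma sample_pmf_entropic:
  assumes "N > 0"
  shows "entropic_vector n (sample_pmf n N t) \<in> entropic n"
proof -
  define D where "D v = (\<lambda>i. code_nth (code_nth t i) v) ` {..<N}" for v
  have "outcome n t i \<in> Pi\<^sub>E {..<n} D" if "i < N" for i
    unfolding outcome_def restrict_PiE_iff using that by (simp add: D_def)
  then have "set_pmf (sample_pmf n N t) \<subseteq> Pi\<^sub>E {..<n} D"
    using assms by (auto simp: sample_pmf_def set_pmf_of_set lessThan_empty_iff)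
  moreover have "\<forall>i<n. finite (D i)"
    by (simp add: D_def)
  ultimately show ?thesis
    unfolding entropic_def mem_Collect_eq by (intro exI[of _ "sample_pmf n N t"] exI[of _ D] conjI refl)
qed

subsection \<open>Density of rational distributions\<close>

lemma ex_code_table: "\<exists>t. \<forall>i<N. \<forall>v<n. code_nth (code_nth t i) v = X i v"
proof -
  define t where "t = list_encode (map (\<lambda>i. list_encode (map (X i) [0..<n])) [0..<N])"
  have "code_nth (code_nth t i) v = X i v" if "i < N" "v < n" for i v
    using that by (simp add: t_def code_nth_list_encode)
  then show ?thesis
    by blast
qed

text \<open>An enumeration of \<open>A\<close> turns sample points into row numbers. Extensionality
  of the values of \<open>f\<close> ensures that a row of \<open>n\<close> entries determines the
  whole tuple.\<close>

lemma sample_pmf_of_finite_sample: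
  assumes A: "finite A" "A \<noteq> {}" and f: "f ` A \<subseteq> extensional {..<n}"
  shows "\<exists>t. sample_pmf n (card A) t = map_pmf f (pmf_of_set A)"
proof -
  obtain g where g: "bij_betw g {..<card A} A"
    using ex_bij_betw_nat_finite[OF A(1)] by (auto simp: atLeast0LessThan)
  obtain t where t: "\<And>i v. i < card A \<Longrightarrow> v < n \<Longrightarrow> code_nth (code_nth t i) v = f (g i) v"
    using ex_code_table[of "card A" n "\<lambda>i. f (g i)"] by blast
  have "outcome n t i = f (g i)" if "i < card A" for i
  proof -
    have "f (g i) \<in> extensional {..<n}"
      using f bij_betw_apply[OF g] that by auto
    then show ?thesis
      using that t by (auto simp: outcome_def fun_eq_iff extensional_def)
  qed
  then have "sample_pmf n (card A) t = map_pmf (f \<circ> g) (pmf_of_set {..<card A})"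
    using A unfolding sample_pmf_def
    by (intro map_pmf_cong) (simp_all add: set_pmf_of_set lessThan_empty_iff)
  also have "\<dots> = map_pmf f (pmf_of_set A)"
    using map_pmf_of_set_bij_betw[OF g] A
    by (simp add: lessThan_empty_iff flip: pmf.map_comp)
  finally show ?thesis ..
qed

text \<open>With a common finite support, all the entropies are sums over one index set, and the
  limit probabilities there are positive, where \<open>log\<close> is continuous.\<close>

lemma tendsto_shannon_entropy_map_pmf:
  assumes S: "finite S" "\<And>j. set_pmf (q j) = S" "set_pmf p = S"
    and lim: "\<And>x. x \<in> S \<Longrightarrow> (\<lambda>j. pmf (q j) x) \<longlonglongrightarrow> pmf p x"
  shows "(\<lambda>j. shannon_entropy (map_pmf f (q j))) \<longlonglongrightarrow> shannon_entropy (map_pmf f p)"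
proof -
  have pmf: "pmf (map_pmf f r) y = (\<Sum>x\<in>{x\<in>S. f x = y}. pmf r x)" if "set_pmf r = S" for r y
  proof -
    have "pmf (map_pmf f r) y = measure r (f -` {y} \<inter> set_pmf r)"
      by (simp add: pmf_map measure_Int_set_pmf)
    also have "f -` {y} \<inter> set_pmf r = {x\<in>S. f x = y}"
      using that by auto
    also have "measure r \<dots> = (\<Sum>x\<in>{x\<in>S. f x = y}. pmf r x)"
      using S(1) by (simp add: measure_measure_pmf_finite)
    finally show ?thesis .
  qed
  have lim': "(\<lambda>j. pmf (map_pmf f (q j)) y) \<longlonglongrightarrow> pmf (map_pmf f p) y" for y
    unfolding pmf[OF S(2)] pmf[OF S(3)] by (intro tendsto_sum lim) auto
  have "pmf (map_pmf f p) y > 0" if "y \<in> f ` S" for y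
    using that S(3) by (intro pmf_positive) auto
  then show ?thesis
    unfolding shannon_entropy_def set_map_pmf S(2,3)
    by (intro tendsto_minus tendsto_sum tendsto_mult tendsto_log lim' tendsto_const) force+
qed

text \<open>Over each \<open>x\<close> in the support stand about \<open>j * pmf p x\<close> equally
  likely copies; their relative frequency tends to \<open>pmf p x\<close>.\<close>

lemma finite_pmf_approx:
  assumes S: "finite (set_pmf p)"
  obtains A :: "nat \<Rightarrow> ('a \<times> nat) set"
  where "\<And>j. finite (A j)" "\<And>j. A j \<noteq> {}" "\<And>j. fst ` A j = set_pmf p"
    "\<And>x. (\<lambda>j. pmf (map_pmf fst (pmf_of_set (A j))) x) \<longlonglongrightarrow> pmf p x"
proof -
  define S where "S = set_pmf p"
  have fin: "finite S"
    using assms by (simp add: S_def)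
  \<comment> \<open>The successor keeps the support equal to that of \<open>p\<close>, so that entropy is continuous along
    the sequence.\<close>
  define a where "a j x = Suc (nat \<lfloor>real j * pmf p x\<rfloor>)" for j x
  define A where "A j = (SIGMA x:S. {..<a j x})" for j
  have finA: "finite (A j)" for j
    using fin by (simp add: A_def)
  have fstA: "fst ` A j = S" for j
    by (force simp: A_def a_def)
  have neA: "A j \<noteq> {}" for j
    using fstA[of j] set_pmf_not_empty[of p] by (auto simp: S_def)
  have cardA: "card (A j) = (\<Sum>x\<in>S. a j x)" for j
    using fin by (simp add: A_def)
  have lim_a: "(\<lambda>j. a j x / j) \<longlonglongrightarrow> pmf p x" for x
  proof (rule tendsto_sandwich)
    have bounds: "real j * pmf p x \<le> a j x" "a j x \<le> real j * pmf p x + 1" for j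
      using of_int_floor_le[of "real j * pmf p x"] floor_le_iff[of "real j * pmf p x"]
      by (auto simp: a_def) linarith+
    \<comment> \<open>Only positive \<open>j\<close> are considered, since at \<open>j = 0\<close>
      the quotient defaults to \<open>0\<close>.\<close>
    show "\<forall>\<^sub>F j in sequentially. pmf p x \<le> a j x / j"
      using eventually_gt_at_top[of 0] by eventually_elim (use bounds in \<open>simp add: field_simps\<close>)
    show "\<forall>\<^sub>F j in sequentially. a j x / j \<le> pmf p x + 1 / j"
      using eventually_gt_at_top[of 0] by eventually_elim (use bounds in \<open>simp add: field_simps\<close>)
    show "(\<lambda>j. pmf p x + 1 / real j) \<longlonglongrightarrow> pmf p x"
      using tendsto_add[OF tendsto_const lim_1_over_n] by simp
  qed simp
  have "(\<lambda>j. card (A j) / j) \<longlonglongrightarrow> (\<Sum>x\<in>S. pmf p x)"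
    unfolding cardA of_nat_sum sum_divide_distrib by (intro tendsto_sum lim_a)
  then have lim_A: "(\<lambda>j. card (A j) / j) \<longlonglongrightarrow> 1"
    using sum_pmf_eq_1[OF fin, of p] by (simp add: S_def)
  have pmf: "pmf (map_pmf fst (pmf_of_set (A j))) x = (if x \<in> S then a j x / card (A j) else 0)" for j x
  proof -
    have "A j \<inter> fst -` {x} = (if x \<in> S then {x} \<times> {..<a j x} else {})"
      by (auto simp: A_def)
    then show ?thesis
      using finA neA by (simp add: pmf_map measure_pmf_of_set card_cartesian_product)
  qed
  have "(\<lambda>j. pmf (map_pmf fst (pmf_of_set (A j))) x) \<longlonglongrightarrow> pmf p x" for x
  proof (cases "x \<in> S")
    case True
    \<comment> \<open>Neither \<open>a j x\<close> nor \<open>card (A j)\<close> converges, but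
      their quotients by \<open>j\<close> do.\<close>
    have "(\<lambda>j. (a j x / j) / (card (A j) / j)) \<longlonglongrightarrow> pmf p x / 1"
      by (intro tendsto_divide lim_a lim_A) simp
    moreover have "\<forall>\<^sub>F j in sequentially. (a j x / j) / (card (A j) / j) = a j x / card (A j)"
      using eventually_gt_at_top[of 0] by eventually_elim simp
    ultimately have "(\<lambda>j. a j x / card (A j)) \<longlonglongrightarrow> pmf p x / 1"
      by (rule Lim_transform_eventually)
    then show ?thesis
      using True by (simp add: pmf)
  next
    case False
    then show ?thesis
      by (simp add: pmf) (simp add: S_def set_pmf_iff)
  qed
  with finA neA fstA show ?thesis
    using that[of A] by (simp add: S_def)
qed

lemma entropic_limit_of_samples:
  assumes "h \<in> entropic n"
  obtains N t where "\<And>j. N j > 0"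
    "\<And>\<alpha>. \<alpha> \<subseteq> {..<n} \<Longrightarrow> (\<lambda>j. entropic_vector n (sample_pmf n (N j) (t j)) \<alpha>) \<longlonglongrightarrow> h \<alpha>"
proof -
  obtain p D where h: "h = entropic_vector n p" and D: "\<And>i. i < n \<Longrightarrow> finite (D i)"
    and p: "set_pmf p \<subseteq> Pi\<^sub>E {..<n} D"
    using assms by (auto simp: entropic_def)
  have fin: "finite (set_pmf p)"
    using p by (rule finite_subset) (use D in \<open>auto intro: finite_PiE\<close>)
  obtain A :: "nat \<Rightarrow> ((nat \<Rightarrow> nat) \<times> nat) set" where A: "\<And>j. finite (A j)" "\<And>j. A j \<noteq> {}"
    "\<And>j. fst ` A j = set_pmf p" "\<And>x. (\<lambda>j. pmf (map_pmf fst (pmf_of_set (A j))) x) \<longlonglongrightarrow> pmf p x"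
    using finite_pmf_approx[OF fin] by metis
  have "\<forall>j. \<exists>t. sample_pmf n (card (A j)) t = map_pmf fst (pmf_of_set (A j))"
    using A p by (intro allI sample_pmf_of_finite_sample) (auto simp: PiE_def)
  then obtain t where t: "\<And>j. sample_pmf n (card (A j)) (t j) = map_pmf fst (pmf_of_set (A j))"
    by metis
  show ?thesis
  proof (rule that[of "\<lambda>j. card (A j)" t])
    show "card (A j) > 0" for j
      using A by (simp add: card_gt_0_iff)
    show "(\<lambda>j. entropic_vector n (sample_pmf n (card (A j)) (t j)) \<alpha>) \<longlonglongrightarrow> h \<alpha>" if "\<alpha> \<subseteq> {..<n}" for \<alpha>
      using that A fin unfolding t h
      by (simp add: entropic_vector_def tendsto_shannon_entropy_map_pmf)
  qed
qed

subsection \<open>Monotone constraints are closed\<close>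

lemma bform_eval_no_vars: "bform_vars F = {} \<Longrightarrow> bform_eval F bs = bform_eval F bs'"
  by (induction F) auto

text \<open>An atom defines a closed half-space, the preimage of \<open>{0..}\<close> under a
  continuous linear map; conjunction and disjunction become finite intersections and unions.\<close>

lemma closedin_info_constraint:
  assumes "bform_vars F \<subseteq> {..<m}" "monotone_formula F"
  shows "closedin (powertop_real (Pow {..<n}))
    {h \<in> extensional (Pow {..<n}). info_constraint m (bform_eval F) n c h}"
  using assms unfolding info_constraint_def
proof (induction F)
  case (Const b)
  then show ?case
    using closedin_topspace[of "powertop_real (Pow {..<n})"] by (cases b) (auto simp: PiE_def)
next
  case (Var i)
  have "continuous_map (powertop_real (Pow {..<n})) euclideanreal (dot n (c i))"
    unfolding dot_def
    by (intro continuous_map_sum continuous_map_real_mult continuous_map_product_projection)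
      auto
  from closedin_continuous_map_preimage[OF this, of "{0..}"]
  have "closedin (powertop_real (Pow {..<n})) {h \<in> extensional (Pow {..<n}). dot n (c i) h \<ge> 0}"
    by (simp add: PiE_def)
  with Var show ?case
    by simp
next
  \<comment> \<open>Monotonicity leaves only negations of variable-free formulas, which define the
    empty set or the whole space.\<close>
  case (Neg F)
  then have "(\<not> bform_eval F bs) = (\<not> bform_eval F [])" for bs
    using bform_eval_no_vars[of F bs "[]"] by simp
  then show ?case
    using closedin_topspace[of "powertop_real (Pow {..<n})"]
    by (cases "bform_eval F []") (auto simp: PiE_def)
next
  case (And F G)
  have "{h \<in> X. P h \<and> Q h} = {h \<in> X. P h} \<inter> {h \<in> X. Q h}" for P Q and X :: "'z set"
    by auto
  note eq = this
  show ?case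
    unfolding bform_eval.simps eq using And by (intro closedin_Int) simp_all
next
  case (Or F G)
  have "{h \<in> X. P h \<or> Q h} = {h \<in> X. P h} \<union> {h \<in> X. Q h}" for P Q and X :: "'z set"
    by auto
  note eq = this
  show ?case
    unfolding bform_eval.simps eq using Or by (intro closedin_Un) simp_all
qed

lemma entropic_extensional: "entropic n \<subseteq> extensional (Pow {..<n})"
  by (auto simp: entropic_def entropic_vector_def)

text \<open>A closed set containing all entropic vectors contains their closure.\<close>

lemma AEBIC_eq_EBIC:
  assumes "bform_vars F \<subseteq> {..<m}" "monotone_formula F"
  shows "AEBIC m (bform_eval F) = EBIC m (bform_eval F)"
proof -
  have "(\<forall>h\<in>almost_entropic n. info_constraint m (bform_eval F) n c h) \<longleftrightarrow>
      (\<forall>h\<in>entropic n. info_constraint m (bform_eval F) n c h)" for n c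
  proof
    assume "\<forall>h\<in>almost_entropic n. info_constraint m (bform_eval F) n c h"
    moreover have "entropic n \<subseteq> almost_entropic n"
      unfolding almost_entropic_def
      by (rule closure_of_subset) (use entropic_extensional in \<open>auto simp: PiE_def\<close>)
    ultimately show "\<forall>h\<in>entropic n. info_constraint m (bform_eval F) n c h"
      by blast
  next
    assume *: "\<forall>h\<in>entropic n. info_constraint m (bform_eval F) n c h"
    have "almost_entropic n \<subseteq> {h \<in> extensional (Pow {..<n}). info_constraint m (bform_eval F) n c h}"
      unfolding almost_entropic_def
      by (rule closure_of_minimal) (use * entropic_extensional closedin_info_constraint[OF assms] in auto)
    then show "\<forall>h\<in>almost_entropic n. info_constraint m (bform_eval F) n c h"
      by blast
  qed
  then show ?thesis
    by (simp add: AEBIC_def EBIC_def)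
qed

text \<open>Closedness again: a constraint true on all samples passes to their limits, which include
  every entropic vector. Counterexamples may thus be sought among countably many tables.\<close>

lemma info_constraint_entropic_iff_samples:
  assumes "bform_vars F \<subseteq> {..<m}" "monotone_formula F"
  shows "(\<forall>h\<in>entropic n. info_constraint m (bform_eval F) n c h) \<longleftrightarrow>
    (\<forall>N>0. \<forall>t. info_constraint m (bform_eval F) n c (entropic_vector n (sample_pmf n N t)))"
proof
  assume samples: "\<forall>N>0. \<forall>t. info_constraint m (bform_eval F) n c (entropic_vector n (sample_pmf n N t))"
  show "\<forall>h\<in>entropic n. info_constraint m (bform_eval F) n c h"
  proof
    fix h assume h: "h \<in> entropic n"
    obtain N t where N: "\<And>j. N j > 0" and
      lim: "\<And>\<alpha>. \<alpha> \<subseteq> {..<n} \<Longrightarrow> (\<lambda>j. entropic_vector n (sample_pmf n (N j) (t j)) \<alpha>) \<longlonglongrightarrow> h \<alpha>"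
      using entropic_limit_of_samples[OF h] by metis
    have "limitin (powertop_real (Pow {..<n})) (\<lambda>j. entropic_vector n (sample_pmf n (N j) (t j))) h sequentially"
      using lim entropic_extensional h
      by (auto simp: limitin_componentwise entropic_vector_def PiE_def)
    then have "h \<in> {h \<in> extensional (Pow {..<n}). info_constraint m (bform_eval F) n c h}"
      by (rule limitin_closedin[OF _ closedin_info_constraint[OF assms]])
        (use samples N in \<open>auto simp: entropic_vector_def\<close>)
    then show "info_constraint m (bform_eval F) n c h"
      by simp
  qed
qed (use sample_pmf_entropic in blast)

subsection \<open>The refutation procedure\<close>

text \<open>\<open>F\<close> is a fixed parameter and not an input, so the decision procedure is
  assembled by induction on \<open>F\<close>.\<close>

lemma decidable_bform_eval:
  assumes "bform_vars F \<subseteq> {..<m}" "\<And>j. j < m \<Longrightarrow> decidable k (P j)"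
  shows "decidable k (\<lambda>xs. bform_eval F (map (\<lambda>j. P j xs) [0..<m]))"
  using assms(1)
proof (induction F)
  case (Const b)
  then show ?case
    by (simp add: computable_const)
next
  case (Var i)
  then show ?case
    using assms(2) by simp
qed (simp_all only: bform_eval.simps bform_vars.simps Un_subset_iff
    decidable_Not decidable_conj decidable_disj)

text \<open>Every number decodes to a pair, but only \<open>m\<close> rows of \<open>2 ^ n\<close>
  entries form an instance; all other numbers lie in the complement of the problem.\<close>

definition instance_code :: "nat \<Rightarrow> nat \<Rightarrow> bool" where
  "instance_code m x \<longleftrightarrow> code_length_eq (snd (prod_decode x)) m \<and>
     (\<forall>j<m. code_length_eq (code_nth (snd (prod_decode x)) j) (2 ^ fst (prod_decode x)))"

definition instance_entry :: "nat \<Rightarrow> nat \<Rightarrow> nat set \<Rightarrow> int" where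
  "instance_entry x j \<alpha> = int_decode (code_nth (code_nth (snd (prod_decode x)) j) (set_encode \<alpha>))"

lemma instance_code_encode_instance: "instance_code m (encode_instance m n c)"
  by (simp add: instance_code_def encode_instance_def code_length_eq_list_encode code_nth_list_encode)

text \<open>The codings of pairs, lists, integers and finite sets are bijective, so once the lengths
  are right, decoding and encoding again changes nothing.\<close>

lemma encode_instance_entry:
  assumes "instance_code m x"
  shows "encode_instance m (fst (prod_decode x)) (instance_entry x) = x"
proof -
  define n where "n = fst (prod_decode x)"
  define L where "L = list_decode (snd (prod_decode x))"
  have L: "list_encode L = snd (prod_decode x)"
    by (simp add: L_def)
  have len: "length L = m"
    using assms by (simp add: instance_code_def code_length_eq_list_encode flip: L)
  have row: "list_encode (map (\<lambda>k. int_encode (instance_entry x j (set_decode k))) [0..<2 ^ n]) = L ! j"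
    if j: "j < m" for j
  proof -
    define l where "l = list_decode (L ! j)"
    have l: "L ! j = list_encode l"
      by (simp add: l_def)
    have "code_length_eq (L ! j) (2 ^ n)"
      using assms j len by (simp add: instance_code_def code_nth_list_encode n_def flip: L)
    then have "length l = 2 ^ n"
      by (simp add: l code_length_eq_list_encode)
    then have "map (\<lambda>k. int_encode (instance_entry x j (set_decode k))) [0..<2 ^ n] = l"
      using j len by (intro nth_equalityI) (simp_all add: instance_entry_def code_nth_list_encode l flip: L)
    then show ?thesis
      by (simp add: l)
  qed
  have "map (\<lambda>j. list_encode (map (\<lambda>k. int_encode (instance_entry x j (set_decode k))) [0..<2 ^ n])) [0..<m] = L"
    using len row by (intro nth_equalityI) simp_all
  then show ?thesis
    by (simp add: encode_instance_def L flip: n_def) (simp add: n_def)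
qed

lemma mem_EBIC_iff:
  "x \<in> EBIC m F \<longleftrightarrow> instance_code m x \<and> (\<forall>h\<in>entropic (fst (prod_decode x)).
     info_constraint m F (fst (prod_decode x)) (\<lambda>j \<alpha>. real_of_int (instance_entry x j \<alpha>)) h)"
proof (cases "instance_code m x")
  case True
  then show ?thesis
    using encode_instance_in_EBIC_iff[of m "fst (prod_decode x)" "instance_entry x" F]
    by (simp add: encode_instance_entry)
next
  case False
  then show ?thesis
    using instance_code_encode_instance by (auto simp: EBIC_def)
qed

text \<open>A witness \<open>w\<close> pairs a sample size with a table; \<open>Suc\<close> keeps
  the size positive. A number that is no instance code is refuted by every \<open>w\<close>.\<close>

definition refutes :: "nat \<Rightarrow> bform \<Rightarrow> nat \<Rightarrow> nat \<Rightarrow> bool" where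
  "refutes m F w x \<longleftrightarrow> \<not> (instance_code m x \<and> bform_eval F (map (\<lambda>j.
     nonneg_test (fst (prod_decode x)) (Suc (fst (prod_decode w))) (snd (prod_decode w))
       (code_nth (snd (prod_decode x)) j)) [0..<m]))"

lemma decidable_refutes:
  assumes "bform_vars F \<subseteq> {..<m}"
  shows "decidable (Suc (Suc 0)) (\<lambda>xs. \<not> refutes m F (hd xs) (hd (tl xs)))"
  unfolding refutes_def instance_code_def not_not
  by (intro decidable_conj decidable_bform_eval assms computable_intros)

lemma ex_refutes_iff:
  assumes "bform_vars F \<subseteq> {..<m}" "monotone_formula F"
  shows "(\<exists>w. refutes m F w x) \<longleftrightarrow> x \<notin> EBIC m (bform_eval F)"
proof -
  define n where "n = fst (prod_decode x)"
  define test where "test N t \<longleftrightarrow> bform_eval F (map (\<lambda>j. nonneg_test n N t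
      (code_nth (snd (prod_decode x)) j)) [0..<m])" for N t
  have test: "test N t \<longleftrightarrow> info_constraint m (bform_eval F) n
      (\<lambda>j \<alpha>. real_of_int (instance_entry x j \<alpha>)) (entropic_vector n (sample_pmf n N t))" if "N > 0" for N t
    unfolding test_def info_constraint_def instance_entry_def nonneg_test_iff[OF that] ..
  have "x \<in> EBIC m (bform_eval F) \<longleftrightarrow> instance_code m x \<and> (\<forall>N>0. \<forall>t. test N t)"
    unfolding mem_EBIC_iff info_constraint_entropic_iff_samples[OF assms]
    by (simp add: test flip: n_def)
  also have "(\<forall>N>0. \<forall>t. test N t) \<longleftrightarrow> (\<forall>w. test (Suc (fst (prod_decode w))) (snd (prod_decode w)))"
  proof (intro iffI allI impI)
    fix N t :: nat
    assume "\<forall>w. test (Suc (fst (prod_decode w))) (snd (prod_decode w))" "N > 0"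
    \<comment> \<open>\<open>N - 1\<close> undoes the \<open>Suc\<close> in the sample size.\<close>
    from this(1)[rule_format, of "prod_encode (N - 1, t)"] this(2) show "test N t"
      by simp
  qed simp
  finally show ?thesis
    by (simp add: refutes_def test_def n_def)
qed

theorem theorem7:
  fixes m :: nat and F :: bform
  assumes "bform_vars F \<subseteq> {..<m}"
    and "monotone_formula F"
  shows "Pi01 (EBIC m (bform_eval F)) \<and> Pi01 (AEBIC m (bform_eval F))"
proof -
  \<comment> \<open>The decidable predicate of the search is the absence of a refutation, hence the
    double negation.\<close>
  have "- EBIC m (bform_eval F) = {x. \<exists>w. \<not> \<not> refutes m F w x}"
    using ex_refutes_iff[OF assms] by auto
  then have "Pi01 (EBIC m (bform_eval F))"
    using rec_enumerable_projection[OF decidable_refutes[OF assms(1)]] by (simp add: Pi01_def)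
  then show ?thesis
    by (simp add: AEBIC_eq_EBIC[OF assms])
qed

end
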